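(* Let $\nu,m_1,m_2,t$ be positive integers with $\nu>m_i\ge t$ for $i\in\{1,2\}$ and $2\nu\ge 2m_1+m_2-t$. Suppose $\mathcal F\subseteq\mathcal P_{m_1}$ and $\mathcal G\subseteq\mathcal P_{m_2}$ are nonempty cross $t$-intersecting families. Then $$|\mathcal F|\le {\tau_t(\mathcal F)\brack t}{m_2-t+1\brack 1}^{\tau_t(\mathcal G)-t}N'(\tau_t(\mathcal G);m_1;2\nu).$$
   Context: Let $q$ be a prime power, $\nu\ge 1$ an integer, and $f$ a non-degenerate alternating bilinear form on $V=\mathbb F_q^{2\nu}$. A subspace $W\le V$ is totally isotropic if $f(x,y)=0$ for all $x,y\in W$. For $0\le m\le \nu$, $\mathcal P_m$ denotes the set of all $m$-dimensional totally isotropic subspaces of $V$. Gaussian binomial coefficient: ${n\brack k}=\prod_{i=0}^{k-1}\frac{q^{n-i}-1}{q^{k-i}-1}$, ${n\brack 0}=1$. For integers $0\le a\le m\le\nu$, $N'(a;m;2\nu)=\prod_{i=1}^{m-a}\frac{q^{2(\nu-m+i)}-1}{q^{i}-1}$; this equals the number of members of $\mathcal P_m$ containing a fixed member of $\mathcal P_a$. Families $\mathcal F\subseteq\mathcal P_{m_1}$, $\mathcal G\subseteq\mathcal P_{m_2}$ are cross $t$-intersecting if $\dim(F\cap G)\ge t$ for all $F\in\mathcal F$, $G\in\mathcal G$. For a family $\mathcal H$ of totally isotropic subspaces, a $t$-cover of $\mathcal H$ is a totally isotropic subspace $X$ with $\dim(X\cap H)\ge t$ for all $H\in\mathcal H$,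 and $\tau_t(\mathcal H)$ is the minimum dimension of a $t$-cover of $\mathcal H$. *)

theory Defs
  imports "HOL-Analysis.Analysis"
begin

text \<open>V = F_q^(2 nu) is modelled as the type 'a^'n with 'a a finite field (q = CARD('a))
 and CARD('n) = 2 nu. Subspaces and dimensions are those of the library
 interpretation vec (vector space over 'a with scalar multiplication (*s)).\<close>

definition alt_bilinear :: "('a::field^'n \<Rightarrow> 'a^'n \<Rightarrow> 'a) \<Rightarrow> bool" where
  "alt_bilinear f \<longleftrightarrow>
     (\<forall>x. Vector_Spaces.linear (*s) (*) (\<lambda>y. f x y)) \<and>
     (\<forall>y. Vector_Spaces.linear (*s) (*) (\<lambda>x. f x y)) \<and>
     (\<forall>x. f x x = 0)"

definition nondegenerate :: "('a::field^'n \<Rightarrow> 'a^'n \<Rightarrow> 'a) \<Rightarrow> bool" where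
  "nondegenerate f \<longleftrightarrow> (\<forall>x. (\<forall>y. f x y = 0) \<longrightarrow> x = 0)"

definition tot_iso :: "('a::field^'n \<Rightarrow> 'a^'n \<Rightarrow> 'a) \<Rightarrow> ('a^'n) set \<Rightarrow> bool" where
  "tot_iso f W \<longleftrightarrow> vec.subspace W \<and> (\<forall>x\<in>W. \<forall>y\<in>W. f x y = 0)"

text \<open>P_m: the m-dimensional totally isotropic subspaces.\<close>
definition Pm :: "('a::field^'n \<Rightarrow> 'a^'n \<Rightarrow> 'a) \<Rightarrow> nat \<Rightarrow> ('a^'n) set set" where
  "Pm f m = {W. tot_iso f W \<and> vec.dim W = m}"

definition cross_t_intersecting :: "('a::field^'n) set set \<Rightarrow> ('a^'n) set set \<Rightarrow> nat \<Rightarrow> bool" where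
  "cross_t_intersecting F G t \<longleftrightarrow> (\<forall>A\<in>F. \<forall>B\<in>G. vec.dim (A \<inter> B) \<ge> t)"

definition t_cover :: "('a::field^'n \<Rightarrow> 'a^'n \<Rightarrow> 'a) \<Rightarrow> nat \<Rightarrow> ('a^'n) set set \<Rightarrow> ('a^'n) set \<Rightarrow> bool" where
  "t_cover f t H X \<longleftrightarrow> tot_iso f X \<and> (\<forall>A\<in>H. vec.dim (X \<inter> A) \<ge> t)"

definition tau :: "('a::field^'n \<Rightarrow> 'a^'n \<Rightarrow> 'a) \<Rightarrow> nat \<Rightarrow> ('a^'n) set set \<Rightarrow> nat" where
  "tau f t H = (LEAST d. \<exists>X. t_cover f t H X \<and> vec.dim X = d)"

text \<open>Gaussian binomial coefficient [n brack k]_q.\<close>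
definition gauss_binom :: "nat \<Rightarrow> nat \<Rightarrow> nat \<Rightarrow> real" where
  "gauss_binom q n k = (\<Prod>i<k. (real q ^ (n - i) - 1) / (real q ^ (k - i) - 1))"

text \<open>N'(a; m; 2 nu).\<close>
definition Nprime :: "nat \<Rightarrow> nat \<Rightarrow> nat \<Rightarrow> nat \<Rightarrow> real" where
  "Nprime q a m \<nu> = (\<Prod>i=1..m - a. (real q ^ (2 * (\<nu> - m + i)) - 1) / (real q ^ i - 1))"

end

theory Submission
  imports Defs
begin

text \<open>Let \<open>X\<close> be a \<open>t\<close>-cover of \<open>F\<close> of dimension \<open>\<tau>\<^sub>t(F)\<close> and \<open>s = \<tau>\<^sub>t(G)\<close>. Every member
  of \<open>F\<close> contains one of the at most \<open>[\<tau>\<^sub>t(F), t]\<close> \<open>t\<close>-subspaces of \<open>X\<close>. A totally isotropic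
  \<open>T\<close> of dimension \<open>< s\<close> is not a \<open>t\<close>-cover of \<open>G\<close>, which lets one replace \<open>T\<close> by at most
  \<open>[m2 - t + 1, 1]\<close> totally isotropic spaces of dimension \<open>dim T + 1\<close> such that every member of
  \<open>F\<close> above \<open>T\<close> contains one of them. After \<open>s - t\<close> steps every member of \<open>F\<close> contains one of
  at most \<open>[\<tau>\<^sub>t(F), t] [m2 - t + 1, 1]\<^bsup>s - t\<^esup>\<close> totally isotropic \<open>s\<close>-spaces, each lying in
  at most \<open>N'(s; m1; 2\<nu>)\<close> members of \<open>P\<^sub>m\<^sub>1\<close>. The two counting bounds come from counting
  ordered bases in two ways.\<close>

section \<open>Alternating forms and orthogonal complements\<close>

lemma alt_bilinearD:
  fixes f :: "'a::field^'n \<Rightarrow> 'a^'n \<Rightarrow> 'a"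
  assumes "alt_bilinear f"
  shows "f (x + y) z = f x z + f y z" "f z (x + y) = f z x + f z y"
    and "f (c *s x) z = c * f x z" "f z (c *s x) = c * f z x"
    and "f x x = 0" "f 0 z = 0" "f z 0 = 0"
proof -
  have lin: "Vector_Spaces.linear (*s) (*) (\<lambda>y. f z y)" "Vector_Spaces.linear (*s) (*) (\<lambda>x. f x z)"
    for z using assms unfolding alt_bilinear_def by auto
  show "f (x + y) z = f x z + f y z" "f (c *s x) z = c * f x z"
    using lin(2)[of z] by (simp_all add: Vector_Spaces.linear_iff)
  show "f 0 z = 0"
    using lin(2)[of z] by (metis Vector_Spaces.linear_iff mult_zero_left vec.scale_zero_left)
  show "f z (x + y) = f z x + f z y" "f z (c *s x) = c * f z x"
    using lin(1)[of z] by (simp_all add: Vector_Spaces.linear_iff)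
  show "f z 0 = 0"
    using lin(1)[of z] by (metis Vector_Spaces.linear_iff mult_zero_left vec.scale_zero_left)
  show "f x x = 0" using assms unfolding alt_bilinear_def by auto
qed

lemma alt_bilinear_skew:
  fixes f :: "'a::field^'n \<Rightarrow> 'a^'n \<Rightarrow> 'a"
  assumes "alt_bilinear f"
  shows "f x y = - f y x"
proof -
  have "0 = f (x + y) (x + y)" using alt_bilinearD(5)[OF assms] by simp
  also have "\<dots> = f x x + f x y + f y x + f y y"
    by (simp only: alt_bilinearD(1,2)[OF assms] add_ac)
  also have "\<dots> = f x y + f y x" by (simp add: alt_bilinearD(5)[OF assms])
  finally show ?thesis by (metis add.commute eq_neg_iff_add_eq_0)
qed

definition perp :: "('a::field^'n \<Rightarrow> 'a^'n \<Rightarrow> 'a) \<Rightarrow> ('a^'n) set \<Rightarrow> ('a^'n) set" where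
  "perp f U = {x. \<forall>u\<in>U. f u x = 0}"

lemma subspace_perp:
  fixes f :: "'a::field^'n \<Rightarrow> 'a^'n \<Rightarrow> 'a"
  assumes "alt_bilinear f"
  shows "vec.subspace (perp f U)"
  unfolding vec.subspace_def perp_def by (auto simp: alt_bilinearD[OF assms])

lemma perp_span:
  fixes f :: "'a::field^'n \<Rightarrow> 'a^'n \<Rightarrow> 'a"
  assumes "alt_bilinear f"
  shows "perp f (vec.span U) = perp f U"
proof
  show "perp f (vec.span U) \<subseteq> perp f U" unfolding perp_def using vec.span_base by blast
  show "perp f U \<subseteq> perp f (vec.span U)"
  proof
    fix x assume "x \<in> perp f U"
    then have "U \<subseteq> {u. f u x = 0}" unfolding perp_def by auto
    moreover have "vec.subspace {u. f u x = 0}"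
      unfolding vec.subspace_def by (auto simp: alt_bilinearD[OF assms])
    ultimately have "vec.span U \<subseteq> {u. f u x = 0}" by (rule vec.span_minimal)
    then show "x \<in> perp f (vec.span U)" unfolding perp_def by auto
  qed
qed

lemma isotropic_span:
  fixes f :: "'a::field^'n \<Rightarrow> 'a^'n \<Rightarrow> 'a"
  assumes "alt_bilinear f" "\<forall>a\<in>A. \<forall>b\<in>A. f a b = 0"
  shows "\<forall>a\<in>vec.span A. \<forall>b\<in>vec.span A. f a b = 0"
proof -
  have "A \<subseteq> perp f A" using assms(2) unfolding perp_def by auto
  then have "vec.span A \<subseteq> perp f A" using vec.span_minimal subspace_perp[OF assms(1)] by blast
  then have "vec.span A \<subseteq> perp f (vec.span A)" using perp_span[OF assms(1)] by simp
  then show ?thesis unfolding perp_def by auto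
qed

lemma perp_UNIV:
  fixes f :: "'a::field^'n \<Rightarrow> 'a^'n \<Rightarrow> 'a"
  assumes "alt_bilinear f" "nondegenerate f"
  shows "perp f UNIV = {0}"
proof
  show "perp f UNIV \<subseteq> {0}"
  proof
    fix x assume "x \<in> perp f UNIV"
    then have "\<forall>y. f x y = 0"
      unfolding perp_def using alt_bilinear_skew[OF assms(1), of x] by auto
    then show "x \<in> {0}" using assms(2) unfolding nondegenerate_def by auto
  qed
  show "{0} \<subseteq> perp f UNIV" unfolding perp_def using alt_bilinearD(7)[OF assms(1)] by auto
qed

lemma dim_le_Suc_dim_Int_kernel:
  fixes S :: "('a::field^'n) set" and \<phi> :: "'a^'n \<Rightarrow> 'a"
  assumes S: "vec.subspace S"
    and add: "\<And>x y. \<phi> (x + y) = \<phi> x + \<phi> y" and scale: "\<And>c x. \<phi> (c *s x) = c * \<phi> x"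
  shows "vec.dim S \<le> vec.dim (S \<inter> {x. \<phi> x = 0}) + 1"
proof (cases "S \<subseteq> {x. \<phi> x = 0}")
  case True
  then show ?thesis by (simp add: Int_absorb2)
next
  case False
  then obtain a where a: "a \<in> S" "\<phi> a \<noteq> 0" by blast
  let ?K = "S \<inter> {x. \<phi> x = 0}"
  have "S \<subseteq> vec.span (insert a ?K)"
  proof
    fix x assume x: "x \<in> S"
    let ?k = "\<phi> x / \<phi> a"
    have "\<phi> (x - ?k *s a) = \<phi> x - ?k * \<phi> a"
      using add[of "x - ?k *s a" "?k *s a"] scale[of ?k a] by (simp add: algebra_simps)
    also have "\<dots> = 0" using a by simp
    finally have "x - ?k *s a \<in> ?K" using x a S by (simp add: vec.subspace_diff vec.subspace_scale)
    then have "x - ?k *s a \<in> vec.span ?K" by (rule vec.span_base)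
    then show "x \<in> vec.span (insert a ?K)" unfolding vec.span_insert by blast
  qed
  then have "vec.dim S \<le> vec.dim (insert a ?K)" by (rule vec.dim_mono)
  also have "\<dots> \<le> vec.dim ?K + 1" by (simp add: vec.dim_insert)
  finally show ?thesis .
qed

lemma dim_le_CARD: "vec.dim (U :: ('a::field^'n) set) \<le> CARD('n)"
  by (metis vec.dim_subset subset_UNIV vec_dim_card)

lemma dim_perp_add_le:
  fixes f :: "'a::field^'n \<Rightarrow> 'a^'n \<Rightarrow> 'a"
  assumes bf: "alt_bilinear f" and nd: "nondegenerate f"
  shows "vec.dim (perp f U) + vec.dim U \<le> CARD('n)"
proof (induction "CARD('n) - vec.dim U" arbitrary: U rule: less_induct)
  case less
  show ?case
  proof (cases "vec.span U = UNIV")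
    case True
    then have "perp f U = {0}" using perp_span[OF bf, of U] perp_UNIV[OF bf nd] by simp
    then show ?thesis using dim_le_CARD[of U] by simp
  next
    case False
    then obtain v where v: "v \<notin> vec.span U" by blast
    have dim_insert: "vec.dim (insert v U) = vec.dim U + 1" using v by (simp add: vec.dim_insert)
    then have "CARD('n) - vec.dim (insert v U) < CARD('n) - vec.dim U"
      using dim_le_CARD[of "insert v U"] by simp
    then have IH: "vec.dim (perp f (insert v U)) + vec.dim (insert v U) \<le> CARD('n)"
      by (rule less.hyps)
    have "perp f (insert v U) = perp f U \<inter> {x. f v x = 0}" unfolding perp_def by auto
    moreover have "vec.dim (perp f U) \<le> vec.dim (perp f U \<inter> {x. f v x = 0}) + 1"
      by (rule dim_le_Suc_dim_Int_kernel[OF subspace_perp[OF bf]]) (simp_all add: alt_bilinearD[OF bf])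
    ultimately show ?thesis using IH dim_insert by simp
  qed
qed

section \<open>Counting vectors and subspaces over a finite field\<close>

lemma two_le_card_field: "2 \<le> CARD('a::{finite,field})"
proof -
  have "card {0::'a, 1} = 2" by simp
  moreover have "card {0::'a, 1} \<le> CARD('a)" by (rule card_mono) auto
  ultimately show ?thesis by simp
qed

lemma of_nat_power_diff:
  assumes "i \<le> d" "1 \<le> q"
  shows "real (q ^ d - q ^ i) = real q ^ i * (real q ^ (d - i) - 1)"
proof -
  have "q ^ i \<le> q ^ d" using assms by (simp add: power_increasing)
  then have "real (q ^ d - q ^ i) = real q ^ d - real q ^ i" by (simp add: of_nat_diff)
  also have "real q ^ d = real q ^ i * real q ^ (d - i)" using assms(1) by (simp add: power_add[symmetric])
  finally show ?thesis by (simp add: algebra_simps)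
qed

lemma card_span_insert:
  fixes b :: "'a::{finite,field}^'n"
  assumes b: "b \<notin> vec.span B"
  shows "card (vec.span (insert b B)) = CARD('a) * card (vec.span B)"
proof -
  let ?g = "\<lambda>(c, x). x + c *s b"
  have "vec.span (insert b B) = ?g ` (UNIV \<times> vec.span B)"
  proof
    show "vec.span (insert b B) \<subseteq> ?g ` (UNIV \<times> vec.span B)"
    proof
      fix x assume "x \<in> vec.span (insert b B)"
      then obtain k where "x - k *s b \<in> vec.span B" unfolding vec.span_insert by blast
      then show "x \<in> ?g ` (UNIV \<times> vec.span B)"
        by (intro image_eqI[where x="(k, x - k *s b)"]) auto
    qed
    show "?g ` (UNIV \<times> vec.span B) \<subseteq> vec.span (insert b B)"
    proof clarify
      fix c x assume "x \<in> vec.span B"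
      then show "x + c *s b \<in> vec.span (insert b B)"
        unfolding vec.span_insert by (intro CollectI exI[of _ c]) simp
    qed
  qed
  moreover have "inj_on ?g (UNIV \<times> vec.span B)"
  proof (rule inj_onI, clarify)
    fix c x c' x' assume x: "x \<in> vec.span B" and x': "x' \<in> vec.span B"
      and e: "x + c *s b = x' + c' *s b"
    show "c = c' \<and> x = x'"
    proof (cases "c = c'")
      case True then show ?thesis using e by simp
    next
      case False
      have "(c - c') *s b = x' - x" using e by (simp add: vec.scale_left_diff_distrib algebra_simps)
      then have "b = inverse (c - c') *s (x' - x)" using False by (metis vec.scale_left_imp_eq
        vec.scale_scale left_inverse right_minus_eq vec.scale_one)
      then have "b \<in> vec.span B" using x x' by (simp add: vec.span_diff vec.span_scale)
      then show ?thesis using b by simp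
    qed
  qed
  ultimately show ?thesis by (simp add: card_image card_cartesian_product)
qed

lemma card_span_independent:
  fixes B :: "('a::{finite,field}^'n) set"
  assumes "vec.independent B"
  shows "card (vec.span B) = CARD('a) ^ card B"
proof -
  have "finite B" by simp
  then show ?thesis using assms
  proof (induction B rule: finite_induct)
    case empty then show ?case by simp
  next
    case (insert b B)
    then have "vec.independent B" "b \<notin> vec.span B" using vec.independent_insert by metis+
    then show ?case using insert.IH insert.hyps card_span_insert[of b B] by simp
  qed
qed

lemma card_subspace:
  fixes S :: "('a::{finite,field}^'n) set"
  assumes "vec.subspace S"
  shows "card S = CARD('a) ^ vec.dim S"
proof -
  obtain B where "vec.independent B" "vec.span B = S" "card B = vec.dim S"
    using vec.basis_subspace_exists[OF assms] by metis
  then show ?thesis using card_span_independent by metis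
qed

lemma dim_Un_Int:
  fixes S T :: "('a::field^'n) set"
  assumes "vec.subspace S" "vec.subspace T"
  shows "vec.dim (S \<union> T) + vec.dim (S \<inter> T) = vec.dim S + vec.dim T"
proof -
  have span: "vec.span S = S" "vec.span T = T" using assms by simp_all
  have "vec.span (S \<union> T) = {x + y |x y. x \<in> S \<and> y \<in> T}"
    by (subst vec.span_Un) (simp only: span)
  then have "vec.dim (S \<union> T) = vec.dim {x + y |x y. x \<in> S \<and> y \<in> T}"
    by (metis vec.dim_span)
  then show ?thesis using vec.dim_sums_Int[OF assms] by simp
qed

lemma span_insert_scale:
  fixes v :: "'a::field^'n"
  assumes "c \<noteq> 0"
  shows "vec.span (insert (c *s v) T) = vec.span (insert v T)"
proof -
  have "v = inverse c *s (c *s v)" using assms by simp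
  then have "v \<in> vec.span (insert (c *s v) T)" by (metis insertI1 vec.span_base vec.span_scale)
  then show ?thesis unfolding vec.span_eq by (auto intro: vec.span_base vec.span_scale)
qed

text \<open>A list in \<open>choice_lists N k\<close> is built by choosing its \<open>j\<close>-th element, counted from the end,
  in \<open>N\<close> of the \<open>j - 1\<close> earlier choices; for \<open>N xs = Y - span (B \<union> set xs)\<close> these are the
  ordered ways of extending \<open>B\<close> by \<open>k\<close> independent vectors of \<open>Y\<close>.\<close>

fun choice_lists :: "('v list \<Rightarrow> 'v set) \<Rightarrow> nat \<Rightarrow> 'v list set" where
  "choice_lists N 0 = {[]}"
| "choice_lists N (Suc k) = (\<Union>xs\<in>choice_lists N k. (\<lambda>x. x # xs) ` N xs)"

lemma length_choice_lists: "xs \<in> choice_lists N k \<Longrightarrow> length xs = k"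
  by (induction k arbitrary: xs) auto

lemma finite_choice_lists: "finite (choice_lists (N :: 'v::finite list \<Rightarrow> 'v set) k)"
  by (induction k) auto

lemma card_choice_lists_Suc:
  "card (choice_lists (N :: 'v::finite list \<Rightarrow> 'v set) (Suc k)) = (\<Sum>xs\<in>choice_lists N k. card (N xs))"
proof -
  have "card (choice_lists N (Suc k)) = (\<Sum>xs\<in>choice_lists N k. card ((\<lambda>x. x # xs) ` N xs))"
    by (simp only: choice_lists.simps, rule card_UN_disjoint) (auto simp: finite_choice_lists)
  also have "\<dots> = (\<Sum>xs\<in>choice_lists N k. card (N xs))"
    by (rule sum.cong) (auto intro: card_image simp: inj_on_def)
  finally show ?thesis .
qed

lemma card_choice_lists_eq:
  fixes N :: "'v::finite list \<Rightarrow> 'v set"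
  assumes "\<And>j xs. j < k \<Longrightarrow> xs \<in> choice_lists N j \<Longrightarrow> card (N xs) = c j"
  shows "card (choice_lists N k) = (\<Prod>j<k. c j)"
  using assms
proof (induction k)
  case 0 then show ?case by simp
next
  case (Suc k)
  have "card (choice_lists N (Suc k)) = (\<Sum>xs\<in>choice_lists N k. c k)"
    unfolding card_choice_lists_Suc by (rule sum.cong) (auto intro: Suc.prems)
  then show ?case using Suc by simp
qed

lemma card_choice_lists_le:
  fixes N :: "'v::finite list \<Rightarrow> 'v set"
  assumes "\<And>j xs. j < k \<Longrightarrow> xs \<in> choice_lists N j \<Longrightarrow> real (card (N xs)) \<le> c j"
    and "\<And>j. j < k \<Longrightarrow> 0 \<le> c j"
  shows "real (card (choice_lists N k)) \<le> (\<Prod>j<k. c j)"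
  using assms
proof (induction k)
  case 0 then show ?case by simp
next
  case (Suc k)
  have "real (card (choice_lists N (Suc k))) = (\<Sum>xs\<in>choice_lists N k. real (card (N xs)))"
    unfolding card_choice_lists_Suc by simp
  also have "\<dots> \<le> (\<Sum>xs\<in>choice_lists N k. c k)"
    by (rule sum_mono) (auto intro: Suc.prems)
  also have "\<dots> = real (card (choice_lists N k)) * c k" by simp
  also have "\<dots> \<le> (\<Prod>j<k. c j) * c k"
    using Suc by (intro mult_right_mono) auto
  finally show ?case by simp
qed

lemma choice_lists_mono:
  assumes "\<And>j xs. j < k \<Longrightarrow> xs \<in> choice_lists N1 j \<Longrightarrow> N1 xs \<subseteq> N2 xs"
  shows "choice_lists N1 k \<subseteq> choice_lists N2 k"
  using assms
proof (induction k)
  case 0 then show ?case by simp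
next
  case (Suc k)
  have "choice_lists N1 k \<subseteq> choice_lists N2 k" by (rule Suc.IH) (rule Suc.prems; simp)
  then show ?case using Suc.prems[of k] by auto blast
qed

lemma choice_lists_span_dim:
  fixes B Y :: "('a::field^'n) set"
  assumes "xs \<in> choice_lists (\<lambda>xs. Y - vec.span (B \<union> set xs)) k"
  shows "set xs \<subseteq> Y" "vec.dim (B \<union> set xs) = vec.dim B + k"
proof -
  have "set xs \<subseteq> Y \<and> vec.dim (B \<union> set xs) = vec.dim B + k"
    using assms
  proof (induction k arbitrary: xs)
    case 0 then show ?case by simp
  next
    case (Suc k)
    then obtain x ys where xs: "xs = x # ys"
      and ys: "ys \<in> choice_lists (\<lambda>xs. Y - vec.span (B \<union> set xs)) k"
      and x: "x \<in> Y" "x \<notin> vec.span (B \<union> set ys)" by auto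
    have "B \<union> set xs = insert x (B \<union> set ys)" using xs by auto
    moreover have "vec.dim (insert x (B \<union> set ys)) = vec.dim (B \<union> set ys) + 1"
      using x(2) by (simp add: vec.dim_insert)
    ultimately show ?case using Suc.IH[OF ys] x xs by auto
  qed
  then show "set xs \<subseteq> Y" "vec.dim (B \<union> set xs) = vec.dim B + k" by auto
qed

lemma card_choice_lists_span:
  fixes B Y :: "('a::{finite,field}^'n) set"
  assumes "vec.subspace Y" "B \<subseteq> Y"
  shows "card (choice_lists (\<lambda>xs. Y - vec.span (B \<union> set xs)) k)
         = (\<Prod>j<k. CARD('a) ^ vec.dim Y - CARD('a) ^ (vec.dim B + j))"
proof (rule card_choice_lists_eq)
  fix j xs assume "xs \<in> choice_lists (\<lambda>xs. Y - vec.span (B \<union> set xs)) j"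
  note dim = choice_lists_span_dim[OF this]
  have "vec.span (B \<union> set xs) \<subseteq> Y" using dim(1) assms vec.span_minimal by blast
  then have "card (Y - vec.span (B \<union> set xs)) = card Y - card (vec.span (B \<union> set xs))"
    by (simp add: card_Diff_subset)
  also have "\<dots> = CARD('a) ^ vec.dim Y - CARD('a) ^ (vec.dim B + j)"
    using card_subspace[OF assms(1)] card_subspace[OF vec.subspace_span, of "B \<union> set xs"] dim(2)
    by simp
  finally show "card (Y - vec.span (B \<union> set xs)) = CARD('a) ^ vec.dim Y - CARD('a) ^ (vec.dim B + j)" .
qed

lemma span_choice_lists_eq:
  fixes B Y :: "('a::field^'n) set"
  assumes "vec.subspace Y" "B \<subseteq> Y" "vec.dim Y = vec.dim B + k"
    and "xs \<in> choice_lists (\<lambda>xs. Y - vec.span (B \<union> set xs)) k"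
  shows "vec.span (B \<union> set xs) = Y"
proof (rule vec.subspace_dim_equal[OF vec.subspace_span assms(1)])
  note dim = choice_lists_span_dim[OF assms(4)]
  show "vec.span (B \<union> set xs) \<subseteq> Y" using dim(1) assms vec.span_minimal by blast
  show "vec.dim Y \<le> vec.dim (vec.span (B \<union> set xs))" using dim(2) assms(3) by simp
qed

lemma card_mult_le_of_fibres:
  assumes "finite A" "finite \<Y>" "\<And>y. y \<in> \<Y> \<Longrightarrow> c \<le> card {a\<in>A. g a = y}"
  shows "card \<Y> * c \<le> card A"
proof -
  have "card \<Y> * c = (\<Sum>y\<in>\<Y>. c)" by simp
  also have "\<dots> \<le> (\<Sum>y\<in>\<Y>. card {a\<in>A. g a = y})" by (rule sum_mono) (use assms in auto)
  also have "\<dots> = card (\<Union>y\<in>\<Y>. {a\<in>A. g a = y})"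
    by (rule card_UN_disjoint[symmetric]) (use assms in auto)
  also have "\<dots> \<le> card A" by (rule card_mono) (use assms in auto)
  finally show ?thesis .
qed

text \<open>Double counting: each \<open>W \<in> \<W>\<close> is the span of \<open>B\<close> together with every list of
  \<open>choice_lists N k\<close> that stays inside \<open>W\<close>, and there are equally many such lists for every \<open>W\<close>.\<close>

lemma card_subspaces_mult_le:
  fixes B :: "('a::{finite,field}^'n) set" and \<W> :: "('a^'n) set set"
  assumes "\<And>W. W \<in> \<W> \<Longrightarrow> vec.subspace W \<and> B \<subseteq> W \<and> vec.dim W = vec.dim B + k"
    and "\<And>W. W \<in> \<W> \<Longrightarrow> choice_lists (\<lambda>xs. W - vec.span (B \<union> set xs)) k \<subseteq> choice_lists N k"
  shows "card \<W> * (\<Prod>j<k. CARD('a) ^ (vec.dim B + k) - CARD('a) ^ (vec.dim B + j))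
         \<le> card (choice_lists N k)"
proof (rule card_mult_le_of_fibres[where g="\<lambda>xs. vec.span (B \<union> set xs)"])
  show "finite (choice_lists N k)" "finite \<W>" by (simp_all add: finite_choice_lists)
  fix W assume W: "W \<in> \<W>"
  let ?L = "choice_lists (\<lambda>xs. W - vec.span (B \<union> set xs)) k"
  have "?L \<subseteq> {xs \<in> choice_lists N k. vec.span (B \<union> set xs) = W}"
    using assms(2)[OF W] span_choice_lists_eq[of W B k] assms(1)[OF W] by auto
  then have "card ?L \<le> card {xs \<in> choice_lists N k. vec.span (B \<union> set xs) = W}"
    by (rule card_mono[rotated]) (simp add: finite_choice_lists)
  then show "(\<Prod>j<k. CARD('a) ^ (vec.dim B + k) - CARD('a) ^ (vec.dim B + j))
      \<le> card {xs \<in> choice_lists N k. vec.span (B \<union> set xs) = W}"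
    using card_choice_lists_span[of W B k] assms(1)[OF W] by simp
qed

lemma exists_complementary_subspace:
  fixes I G :: "('a::{finite,field}^'n) set"
  assumes I: "vec.subspace I" and G: "vec.subspace G" and IG: "I \<subseteq> G"
    and dim: "vec.dim I + k \<le> vec.dim G"
  obtains C where "vec.subspace C" "C \<subseteq> G" "vec.dim C = k" "C \<inter> I \<subseteq> {0}"
proof -
  let ?q = "CARD('a)"
  have "2 \<le> ?q" by (rule two_le_card_field)
  then have "0 < (\<Prod>j<k. ?q ^ vec.dim G - ?q ^ (vec.dim I + j))"
    using dim by (intro prod_pos) (simp add: power_strict_increasing)
  then obtain xs where xs: "xs \<in> choice_lists (\<lambda>xs. G - vec.span (I \<union> set xs)) k"
    using card_choice_lists_span[OF G IG, of k] by (metis card.empty ex_in_conv less_irrefl)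
  note dim_xs = choice_lists_span_dim[OF xs]
  define C where "C = vec.span (set xs)"
  have C: "vec.subspace C" "C \<subseteq> G"
    unfolding C_def using dim_xs(1) G vec.span_minimal by auto
  have "vec.dim C \<le> k"
    using vec.dim_le_card[of "set xs" "set xs"] card_length[of xs] length_choice_lists[OF xs]
    unfolding C_def by (simp add: vec.span_base subsetI)
  moreover have "vec.dim (I \<union> set xs) \<le> vec.dim (I \<union> C)"
    by (rule vec.dim_subset) (auto simp: C_def intro: vec.span_base)
  ultimately have "vec.dim (I \<inter> C) = 0" "vec.dim C = k"
    using dim_Un_Int[OF I C(1)] dim_xs(2) by linarith+
  then show ?thesis using that C by (simp add: Int_commute)
qed

lemma gauss_binom_nonneg:
  assumes "1 \<le> q"
  shows "0 \<le> gauss_binom q n k"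
  unfolding gauss_binom_def using assms
  by (intro prod_nonneg divide_nonneg_nonneg) (simp_all add: one_le_power)

lemma gauss_binom_eq_0:
  assumes "d < k"
  shows "gauss_binom q d k = 0"
  unfolding gauss_binom_def using assms by (intro prod_zero bexI[of _ d]) simp_all

lemma gauss_binom_eq_ratio:
  assumes "2 \<le> q" "k \<le> d"
  shows "gauss_binom q d k = (\<Prod>j<k. real (q ^ d - q ^ j)) / (\<Prod>j<k. real (q ^ k - q ^ j))"
proof -
  have "(\<Prod>j<k. real (q ^ d - q ^ j)) / (\<Prod>j<k. real (q ^ k - q ^ j))
      = (\<Prod>j<k. real (q ^ d - q ^ j) / real (q ^ k - q ^ j))"
    by (simp add: prod_dividef)
  also have "\<dots> = (\<Prod>j<k. (real q ^ (d - j) - 1) / (real q ^ (k - j) - 1))"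
  proof (rule prod.cong[OF refl])
    fix j assume "j \<in> {..<k}"
    then have "j \<le> d" "j \<le> k" "real q ^ j \<noteq> 0" using assms by auto
    then show "real (q ^ d - q ^ j) / real (q ^ k - q ^ j) = (real q ^ (d - j) - 1) / (real q ^ (k - j) - 1)"
      using assms(1) by (simp only: of_nat_power_diff mult_divide_mult_cancel_left) simp_all
  qed
  finally show ?thesis unfolding gauss_binom_def ..
qed

lemma card_subspaces_le:
  fixes X :: "('a::{finite,field}^'n) set"
  assumes X: "vec.subspace X"
  shows "real (card {T. vec.subspace T \<and> T \<subseteq> X \<and> vec.dim T = k})
         \<le> gauss_binom CARD('a) (vec.dim X) k"
proof (cases "k \<le> vec.dim X")
  case False
  have "vec.dim T \<noteq> k" if "T \<subseteq> X" for T using vec.dim_subset[OF that] False by simp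
  then have "{T. vec.subspace T \<and> T \<subseteq> X \<and> vec.dim T = k} = {}" by blast
  then show ?thesis using False gauss_binom_eq_0 by simp
next
  case True
  let ?q = "CARD('a)" and ?\<W> = "{T. vec.subspace T \<and> T \<subseteq> X \<and> vec.dim T = k}"
    and ?E = "{} :: ('a^'n) set"
  have q: "2 \<le> ?q" by (rule two_le_card_field)
  have "card ?\<W> * (\<Prod>j<k. ?q ^ (vec.dim ?E + k) - ?q ^ (vec.dim ?E + j))
      \<le> card (choice_lists (\<lambda>xs. X - vec.span (?E \<union> set xs)) k)"
  proof (rule card_subspaces_mult_le)
    fix W assume W: "W \<in> ?\<W>"
    then show "vec.subspace W \<and> {} \<subseteq> W \<and> vec.dim W = vec.dim ?E + k" by simp
    show "choice_lists (\<lambda>xs. W - vec.span (?E \<union> set xs)) k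
        \<subseteq> choice_lists (\<lambda>xs. X - vec.span (?E \<union> set xs)) k"
      using W by (intro choice_lists_mono) blast
  qed
  also have "\<dots> = (\<Prod>j<k. ?q ^ vec.dim X - ?q ^ (vec.dim ?E + j))"
    by (rule card_choice_lists_span[OF X]) simp
  finally have "real (card ?\<W> * (\<Prod>j<k. ?q ^ k - ?q ^ j)) \<le> real (\<Prod>j<k. ?q ^ vec.dim X - ?q ^ j)"
    by (simp only: of_nat_le_iff vec.dim_empty add_0)
  then have "real (card ?\<W>) * (\<Prod>j<k. real (?q ^ k - ?q ^ j)) \<le> (\<Prod>j<k. real (?q ^ vec.dim X - ?q ^ j))"
    unfolding of_nat_mult of_nat_prod .
  moreover have "0 < (\<Prod>j<k. real (?q ^ k - ?q ^ j))"
    using q by (intro prod_pos) (simp add: power_strict_increasing)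
  ultimately show ?thesis
    using gauss_binom_eq_ratio[OF q True] by (simp add: pos_le_divide_eq)
qed

lemma card_lines_through_le:
  fixes C T :: "('a::{finite,field}^'n) set"
  assumes C: "vec.subspace C"
  shows "real (card ((\<lambda>v. vec.span (insert v T)) ` (C - {0}))) \<le> gauss_binom CARD('a) (vec.dim C) 1"
proof -
  let ?q = "CARD('a)" and ?g = "\<lambda>v. vec.span (insert v T)"
  have q: "2 \<le> ?q" by (rule two_le_card_field)
  have "card (?g ` (C - {0})) * (?q - 1) \<le> card (C - {0})"
  proof (rule card_mult_le_of_fibres[where g = ?g])
    show "finite (C - {0})" "finite (?g ` (C - {0}))" by simp_all
    fix y assume "y \<in> ?g ` (C - {0})"
    then obtain v where v: "v \<in> C" "v \<noteq> 0" "y = ?g v" by auto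
    have "(\<lambda>c. c *s v) ` (UNIV - {0}) \<subseteq> {a \<in> C - {0}. ?g a = y}"
      using v C by (auto simp: span_insert_scale vec.subspace_scale)
    then have "card ((\<lambda>c. c *s v) ` (UNIV - {0})) \<le> card {a \<in> C - {0}. ?g a = y}"
      by (intro card_mono) simp_all
    moreover have "card ((\<lambda>c. c *s v) ` (UNIV - {0})) = ?q - 1"
      using v by (subst card_image) (auto simp: inj_on_def card_Diff_singleton)
    ultimately show "?q - 1 \<le> card {a \<in> C - {0}. ?g a = y}" by simp
  qed
  moreover have "card (C - {0}) = ?q ^ vec.dim C - 1"
    using card_subspace[OF C] vec.subspace_0[OF C] by (simp add: card_Diff_singleton)
  ultimately have "real (card (?g ` (C - {0})) * (?q - 1)) \<le> real (?q ^ vec.dim C - 1)"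
    by (simp only: of_nat_le_iff)
  moreover have "1 \<le> ?q ^ vec.dim C" using q by simp
  ultimately have "real (card (?g ` (C - {0}))) * (real ?q - 1) \<le> real ?q ^ vec.dim C - 1"
    using q by (simp add: of_nat_diff)
  then show ?thesis unfolding gauss_binom_def using q by (simp add: pos_le_divide_eq)
qed

section \<open>Totally isotropic subspaces through a given one\<close>

definition isotropic_extensions ::
  "('a::field^'n \<Rightarrow> 'a^'n \<Rightarrow> 'a) \<Rightarrow> ('a^'n) set \<Rightarrow> ('a^'n) list \<Rightarrow> ('a^'n) set" where
  "isotropic_extensions f T xs = perp f (vec.span (T \<union> set xs)) - vec.span (T \<union> set xs)"

lemma isotropic_extension_lists:
  fixes f :: "'a::field^'n \<Rightarrow> 'a^'n \<Rightarrow> 'a"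
  assumes bf: "alt_bilinear f" and T: "\<forall>a\<in>T. \<forall>b\<in>T. f a b = 0"
    and "xs \<in> choice_lists (isotropic_extensions f T) j"
  shows "\<forall>a\<in>T \<union> set xs. \<forall>b\<in>T \<union> set xs. f a b = 0" "vec.dim (T \<union> set xs) = vec.dim T + j"
proof -
  have "(\<forall>a\<in>T \<union> set xs. \<forall>b\<in>T \<union> set xs. f a b = 0) \<and> vec.dim (T \<union> set xs) = vec.dim T + j"
    using assms(3)
  proof (induction j arbitrary: xs)
    case 0 then show ?case using T by simp
  next
    case (Suc j)
    then obtain x ys where xs: "xs = x # ys" and ys: "ys \<in> choice_lists (isotropic_extensions f T) j"
      and x: "x \<in> perp f (vec.span (T \<union> set ys))" "x \<notin> vec.span (T \<union> set ys)"
      unfolding isotropic_extensions_def by auto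
    let ?W = "T \<union> set ys"
    have IH: "\<forall>a\<in>?W. \<forall>b\<in>?W. f a b = 0" "vec.dim ?W = vec.dim T + j" using Suc.IH[OF ys] by auto
    have xW: "\<forall>a\<in>?W. f a x = 0" using x(1) vec.span_base unfolding perp_def by blast
    then have "\<forall>a\<in>?W. f x a = 0" using alt_bilinear_skew[OF bf] by (metis neg_equal_0_iff_equal)
    with xW have "\<forall>a\<in>insert x ?W. \<forall>b\<in>insert x ?W. f a b = 0"
      using IH(1) alt_bilinearD(5)[OF bf] by blast
    moreover have "vec.dim (insert x ?W) = vec.dim T + Suc j" using x(2) IH(2) by (simp add: vec.dim_insert)
    moreover have "T \<union> set xs = insert x ?W" using xs by auto
    ultimately show ?case by simp
  qed
  then show "\<forall>a\<in>T \<union> set xs. \<forall>b\<in>T \<union> set xs. f a b = 0" "vec.dim (T \<union> set xs) = vec.dim T + j"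
    by auto
qed

lemma card_isotropic_extensions_le:
  fixes f :: "'a::{finite,field}^'n \<Rightarrow> 'a^'n \<Rightarrow> 'a"
  assumes bf: "alt_bilinear f" and nd: "nondegenerate f" and T: "\<forall>a\<in>T. \<forall>b\<in>T. f a b = 0"
    and xs: "xs \<in> choice_lists (isotropic_extensions f T) j"
  shows "real (card (isotropic_extensions f T xs))
         \<le> real CARD('a) ^ (CARD('n) - (vec.dim T + j)) - real CARD('a) ^ (vec.dim T + j)"
proof -
  let ?q = "CARD('a)" and ?d = "vec.dim T + j" and ?W = "vec.span (T \<union> set xs)"
  note iso = isotropic_extension_lists[OF bf T xs]
  have sub: "?W \<subseteq> perp f ?W" using isotropic_span[OF bf iso(1)] unfolding perp_def by auto
  have card_W: "card ?W = ?q ^ ?d" using card_subspace[of ?W] iso(2) by simp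
  have "vec.dim (perp f ?W) \<le> CARD('n) - ?d" using dim_perp_add_le[OF bf nd, of ?W] iso(2) by simp
  then have card_perp: "card (perp f ?W) \<le> ?q ^ (CARD('n) - ?d)"
    using card_subspace[OF subspace_perp[OF bf]] two_le_card_field[where 'a='a]
    by (simp add: power_increasing)
  have "card (isotropic_extensions f T xs) = card (perp f ?W) - card ?W"
    unfolding isotropic_extensions_def using sub by (intro card_Diff_subset) simp_all
  moreover have "card ?W \<le> card (perp f ?W)" using sub by (intro card_mono) simp_all
  ultimately have "real (card (isotropic_extensions f T xs)) = real (card (perp f ?W)) - real (?q ^ ?d)"
    by (simp only: card_W of_nat_diff)
  also have "\<dots> \<le> real (?q ^ (CARD('n) - ?d)) - real (?q ^ ?d)"
    using card_perp by (simp only: diff_right_mono of_nat_le_iff)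
  finally show ?thesis by (simp only: of_nat_power)
qed

lemma card_isotropic_extension_lists_le:
  fixes f :: "'a::{finite,field}^'n \<Rightarrow> 'a^'n \<Rightarrow> 'a"
  assumes bf: "alt_bilinear f" and nd: "nondegenerate f" and T: "\<forall>a\<in>T. \<forall>b\<in>T. f a b = 0"
    and k: "2 * (vec.dim T + k) \<le> CARD('n)"
  shows "real (card (choice_lists (isotropic_extensions f T) k))
         \<le> (\<Prod>j<k. real CARD('a) ^ (CARD('n) - (vec.dim T + j)) - real CARD('a) ^ (vec.dim T + j))"
proof (rule card_choice_lists_le)
  show "real (card (isotropic_extensions f T xs))
      \<le> real CARD('a) ^ (CARD('n) - (vec.dim T + j)) - real CARD('a) ^ (vec.dim T + j)"
    if "xs \<in> choice_lists (isotropic_extensions f T) j" for j xs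
    by (rule card_isotropic_extensions_le[OF bf nd T that])
  show "0 \<le> real CARD('a) ^ (CARD('n) - (vec.dim T + j)) - real CARD('a) ^ (vec.dim T + j)"
    if "j < k" for j
  proof -
    have "vec.dim T + j \<le> CARD('n) - (vec.dim T + j)" using that k by simp
    then show ?thesis using two_le_card_field[where 'a='a] by (simp add: power_increasing)
  qed
qed

lemma Nprime_nonneg:
  assumes "1 \<le> q"
  shows "0 \<le> Nprime q a m \<nu>"
  unfolding Nprime_def using assms
  by (intro prod_nonneg divide_nonneg_nonneg) (simp_all add: one_le_power)

lemma Nprime_eq_ratio:
  assumes q: "2 \<le> q" and "s \<le> m" "m \<le> \<nu>"
  shows "Nprime q s m \<nu> = (\<Prod>j<m - s. real q ^ (2 * \<nu> - (s + j)) - real q ^ (s + j))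
                           / (\<Prod>j<m - s. real (q ^ m - q ^ (s + j)))"
proof -
  let ?k = "m - s"
  have "(\<Prod>j<?k. real q ^ (2 * \<nu> - (s + j)) - real q ^ (s + j)) / (\<Prod>j<?k. real (q ^ m - q ^ (s + j)))
      = (\<Prod>j<?k. (real q ^ (2 * \<nu> - (s + j)) - real q ^ (s + j)) / real (q ^ m - q ^ (s + j)))"
    by (simp add: prod_dividef)
  also have "\<dots> = (\<Prod>j<?k. (real q ^ (2 * (\<nu> - m + (?k - j))) - 1) / (real q ^ (?k - j) - 1))"
  proof (rule prod.cong[OF refl])
    fix j assume "j \<in> {..<?k}"
    then have j: "s + j < m" by auto
    have e: "2 * \<nu> - (s + j) = (s + j) + 2 * (\<nu> - m + (?k - j))" using j assms by simp
    have num: "real q ^ (2 * \<nu> - (s + j)) - real q ^ (s + j)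
        = real q ^ (s + j) * (real q ^ (2 * (\<nu> - m + (?k - j))) - 1)"
      by (simp only: e power_add right_diff_distrib mult_1_right)
    have den: "real (q ^ m - q ^ (s + j)) = real q ^ (s + j) * (real q ^ (?k - j) - 1)"
      using of_nat_power_diff[of "s + j" m q] j q by (simp add: diff_diff_left)
    have "real q ^ (s + j) \<noteq> 0" using q by simp
    then show "(real q ^ (2 * \<nu> - (s + j)) - real q ^ (s + j)) / real (q ^ m - q ^ (s + j))
        = (real q ^ (2 * (\<nu> - m + (?k - j))) - 1) / (real q ^ (?k - j) - 1)"
      unfolding num den by (rule mult_divide_mult_cancel_left)
  qed
  also have "\<dots> = (\<Prod>i=1..?k. (real q ^ (2 * (\<nu> - m + i)) - 1) / (real q ^ i - 1))"
    by (rule prod.reindex_bij_witness[of _ "\<lambda>i. ?k - i" "\<lambda>j. ?k - j"]) auto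
  finally show ?thesis unfolding Nprime_def ..
qed

text \<open>Counting ordered isotropic extensions of \<open>T\<close> in two ways: all of them, and those
  spanning a given member of \<open>P_m\<close> above \<open>T\<close>.\<close>

lemma card_Pm_supersets_le:
  fixes f :: "'a::{finite,field}^'n \<Rightarrow> 'a^'n \<Rightarrow> 'a"
  assumes bf: "alt_bilinear f" and nd: "nondegenerate f" and dim: "CARD('n) = 2 * \<nu>"
    and T: "tot_iso f T" and m: "vec.dim T \<le> m" "m \<le> \<nu>"
  shows "real (card {A \<in> Pm f m. T \<subseteq> A}) \<le> Nprime CARD('a) (vec.dim T) m \<nu>"
proof -
  let ?q = "CARD('a)" and ?s = "vec.dim T" and ?k = "m - vec.dim T"
    and ?\<A> = "{A \<in> Pm f m. T \<subseteq> A}" and ?L = "choice_lists (isotropic_extensions f T) (m - vec.dim T)"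
  have q: "2 \<le> ?q" by (rule two_le_card_field)
  have Tiso: "\<forall>a\<in>T. \<forall>b\<in>T. f a b = 0" using T unfolding tot_iso_def by auto
  have "real (card ?L) \<le> (\<Prod>j<?k. real ?q ^ (2 * \<nu> - (?s + j)) - real ?q ^ (?s + j))"
    using card_isotropic_extension_lists_le[OF bf nd Tiso, of ?k] dim m by simp
  moreover have "card ?\<A> * (\<Prod>j<?k. ?q ^ (?s + ?k) - ?q ^ (?s + j)) \<le> card ?L"
  proof (rule card_subspaces_mult_le)
    fix A assume "A \<in> ?\<A>"
    then have A: "vec.subspace A" "\<forall>a\<in>A. \<forall>b\<in>A. f a b = 0" "vec.dim A = m" "T \<subseteq> A"
      unfolding Pm_def tot_iso_def by auto
    then show "vec.subspace A \<and> T \<subseteq> A \<and> vec.dim A = ?s + ?k" using m by simp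
    show "choice_lists (\<lambda>xs. A - vec.span (T \<union> set xs)) ?k \<subseteq> ?L"
    proof (rule choice_lists_mono)
      fix j ys assume "ys \<in> choice_lists (\<lambda>xs. A - vec.span (T \<union> set xs)) j"
      then have "T \<union> set ys \<subseteq> A" using choice_lists_span_dim(1) A(4) by blast
      then have "vec.span (T \<union> set ys) \<subseteq> A" using A(1) by (rule vec.span_minimal)
      then have "A \<subseteq> perp f (vec.span (T \<union> set ys))" using A(2) unfolding perp_def by blast
      then show "A - vec.span (T \<union> set ys) \<subseteq> isotropic_extensions f T ys"
        unfolding isotropic_extensions_def by blast
    qed
  qed
  then have "real (card ?\<A>) * (\<Prod>j<?k. real (?q ^ m - ?q ^ (?s + j))) \<le> real (card ?L)"
    using m unfolding of_nat_prod[symmetric] of_nat_mult[symmetric] of_nat_le_iff by simp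
  moreover have "0 < (\<Prod>j<?k. real (?q ^ m - ?q ^ (?s + j)))"
    using q by (intro prod_pos) (simp add: power_strict_increasing)
  ultimately have "real (card ?\<A>) \<le> (\<Prod>j<?k. real ?q ^ (2 * \<nu> - (?s + j)) - real ?q ^ (?s + j))
      / (\<Prod>j<?k. real (?q ^ m - ?q ^ (?s + j)))"
    by (simp add: pos_le_divide_eq)
  then show ?thesis using Nprime_eq_ratio[OF q m] by simp
qed

section \<open>Covering families\<close>

lemma tau_le: "t_cover f t H X \<Longrightarrow> tau f t H \<le> vec.dim X"
  unfolding tau_def by (rule Least_le) blast

lemma obtain_minimum_t_cover:
  assumes "t_cover f t H X"
  obtains Y where "t_cover f t H Y" "vec.dim Y = tau f t H"
  using LeastI_ex[of "\<lambda>d. \<exists>X. t_cover f t H X \<and> vec.dim X = d"] assms unfolding tau_def by blast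

lemma le_tau:
  assumes "B \<in> H" "t_cover f t H X"
  shows "t \<le> tau f t H"
proof -
  obtain Y where Y: "t_cover f t H Y" "vec.dim Y = tau f t H"
    using assms(2) by (rule obtain_minimum_t_cover)
  have "t \<le> vec.dim (Y \<inter> B)" using Y(1) assms(1) unfolding t_cover_def by auto
  also have "\<dots> \<le> vec.dim Y" by (rule vec.dim_subset) auto
  finally show ?thesis using Y(2) by simp
qed

lemma real_card_UN_le:
  assumes "finite I" "\<And>i. i \<in> I \<Longrightarrow> real (card (A i)) \<le> c"
  shows "real (card (\<Union>i\<in>I. A i)) \<le> real (card I) * c"
proof -
  have "card (\<Union>i\<in>I. A i) \<le> (\<Sum>i\<in>I. card (A i))" using assms(1) by (rule card_UN_le)
  then have "real (card (\<Union>i\<in>I. A i)) \<le> (\<Sum>i\<in>I. real (card (A i)))"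
    unfolding of_nat_sum[symmetric] of_nat_le_iff .
  also have "\<dots> \<le> (\<Sum>i\<in>I. c)" using assms(2) by (rule sum_mono)
  finally show ?thesis by simp
qed

definition covering_family ::
  "('a::field^'n \<Rightarrow> 'a^'n \<Rightarrow> 'a) \<Rightarrow> ('a^'n) set set \<Rightarrow> nat \<Rightarrow> ('a^'n) set set \<Rightarrow> bool" where
  "covering_family f F d \<T> \<longleftrightarrow> (\<forall>T\<in>\<T>. tot_iso f T \<and> vec.dim T = d) \<and> (\<forall>A\<in>F. \<exists>T\<in>\<T>. T \<subseteq> A)"

lemma cross_t_intersecting_commute:
  "cross_t_intersecting F G t \<longleftrightarrow> cross_t_intersecting G F t"
  unfolding cross_t_intersecting_def by (metis Int_commute)

lemma t_cover_if_cross_t_intersecting: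
  assumes "cross_t_intersecting F G t" "G \<subseteq> Pm f m" "B \<in> G"
  shows "t_cover f t F B"
  using assms unfolding cross_t_intersecting_def t_cover_def Pm_def by (auto simp: Int_commute)

lemma covering_family_of_t_cover:
  fixes F :: "('a::{finite,field}^'n) set set"
  assumes F: "\<And>A. A \<in> F \<Longrightarrow> tot_iso f A" and X: "t_cover f t F X"
  shows "\<exists>\<T>. covering_family f F t \<T> \<and> real (card \<T>) \<le> gauss_binom CARD('a) (vec.dim X) t"
proof -
  let ?\<T> = "{T. tot_iso f T \<and> T \<subseteq> X \<and> vec.dim T = t}"
  have Xsub: "vec.subspace X" using X unfolding t_cover_def tot_iso_def by simp
  have "\<exists>T\<in>?\<T>. T \<subseteq> A" if A: "A \<in> F" for A
  proof -
    have Asub: "vec.subspace A" using F[OF A] unfolding tot_iso_def by simp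
    have "t \<le> vec.dim (X \<inter> A)" using X A unfolding t_cover_def by auto
    then obtain T where T: "vec.subspace T" "T \<subseteq> vec.span (X \<inter> A)" "vec.dim T = t"
      by (rule vec.choose_subspace_of_subspace)
    have "vec.span (X \<inter> A) = X \<inter> A" using vec.subspace_inter[OF Xsub Asub] by simp
    then have "T \<subseteq> X \<inter> A" using T(2) by (simp only:)
    moreover have "tot_iso f T" using T(1) F[OF A] \<open>T \<subseteq> X \<inter> A\<close> unfolding tot_iso_def by blast
    ultimately show ?thesis using T(3) by blast
  qed
  then have "covering_family f F t ?\<T>" unfolding covering_family_def by blast
  moreover have "card ?\<T> \<le> card {T. vec.subspace T \<and> T \<subseteq> X \<and> vec.dim T = t}"
    by (rule card_mono) (auto simp: tot_iso_def)
  then have "real (card ?\<T>) \<le> gauss_binom CARD('a) (vec.dim X) t"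
    using card_subspaces_le[OF Xsub, of t] by linarith
  ultimately show ?thesis by blast
qed

text \<open>A totally isotropic \<open>T\<close> below the covering number of \<open>G\<close> misses some \<open>B \<in> G\<close> in
  dimension \<open>< t\<close>, so \<open>B\<close> contains an \<open>(m2 - t + 1)\<close>-space \<open>C\<close> meeting \<open>T\<close> trivially.
  Every \<open>A \<in> F\<close> above \<open>T\<close> meets \<open>B\<close> in dimension \<open>\<ge> t\<close>, hence meets \<open>C\<close>, hence contains
  one of the at most \<open>[m2 - t + 1, 1]\<close> spaces \<open>T + \<langle>v\<rangle>\<close> with \<open>v \<in> C\<close>.\<close>

lemma branching_step:
  fixes F G :: "('a::{finite,field}^'n) set set"
  assumes G: "G \<subseteq> Pm f m2" "t \<le> m2"
    and F: "\<And>A. A \<in> F \<Longrightarrow> tot_iso f A" and cross: "cross_t_intersecting F G t"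
    and T: "tot_iso f T" "vec.dim T < tau f t G"
  shows "\<exists>\<S>. covering_family f {A \<in> F. T \<subseteq> A} (Suc (vec.dim T)) \<S>
           \<and> real (card \<S>) \<le> gauss_binom CARD('a) (m2 - t + 1) 1"
proof -
  have "\<not> t_cover f t G T" using T(2) tau_le by fastforce
  then obtain B where B: "B \<in> G" "vec.dim (T \<inter> B) < t"
    using T(1) unfolding t_cover_def by force
  have Bsub: "vec.subspace B" "vec.dim B = m2" using B(1) G(1) unfolding Pm_def tot_iso_def by auto
  have Tsub: "vec.subspace T" using T(1) unfolding tot_iso_def by simp
  have "vec.dim (T \<inter> B) + (m2 - t + 1) \<le> vec.dim B" using B(2) Bsub(2) G(2) by linarith
  then obtain C where C: "vec.subspace C" "C \<subseteq> B" "vec.dim C = m2 - t + 1" "C \<inter> (T \<inter> B) \<subseteq> {0}"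
    using exists_complementary_subspace[OF vec.subspace_inter[OF Tsub Bsub(1)] Bsub(1) Int_lower2]
    by metis
  let ?\<S> = "{W \<in> (\<lambda>v. vec.span (insert v T)) ` (C - {0}). tot_iso f W \<and> vec.dim W = Suc (vec.dim T)}"
  have "card ?\<S> \<le> card ((\<lambda>v. vec.span (insert v T)) ` (C - {0}))" by (rule card_mono) auto
  then have "real (card ?\<S>) \<le> gauss_binom CARD('a) (m2 - t + 1) 1"
    using card_lines_through_le[OF C(1), of T] C(3) by simp
  moreover have "\<exists>W\<in>?\<S>. W \<subseteq> A" if A: "A \<in> {A \<in> F. T \<subseteq> A}" for A
  proof -
    from A have A: "A \<in> F" "T \<subseteq> A" by simp_all
    have Asub: "vec.subspace A" using F[OF A(1)] unfolding tot_iso_def by simp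
    have AB: "vec.subspace (A \<inter> B)" using Asub Bsub(1) by (rule vec.subspace_inter)
    have "vec.dim ((A \<inter> B) \<union> C) \<le> vec.dim B" by (rule vec.dim_subset) (use C(2) in auto)
    moreover have "t \<le> vec.dim (A \<inter> B)" using cross A(1) B(1) unfolding cross_t_intersecting_def by blast
    ultimately have "vec.dim ((A \<inter> B) \<inter> C) \<noteq> 0"
      using dim_Un_Int[OF AB C(1)] C(3) Bsub(2) G(2) by linarith
    then obtain v where v: "v \<in> A" "v \<in> C" "v \<noteq> 0" unfolding vec.dim_eq_0 by blast
    have "vec.span T = T" using Tsub by simp
    then have "v \<notin> vec.span T" using v C(2,4) by blast
    then have "vec.dim (vec.span (insert v T)) = Suc (vec.dim T)" by (simp add: vec.dim_insert)
    moreover have "vec.span (insert v T) \<subseteq> A" using v(1) A(2) Asub by (simp add: vec.span_minimal)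
    moreover have "tot_iso f (vec.span (insert v T))"
      using \<open>vec.span (insert v T) \<subseteq> A\<close> F[OF A(1)] unfolding tot_iso_def by blast
    ultimately show ?thesis using v(2,3) by blast
  qed
  then have "covering_family f {A \<in> F. T \<subseteq> A} (Suc (vec.dim T)) ?\<S>"
    unfolding covering_family_def by (intro conjI ballI) simp_all
  ultimately show ?thesis by blast
qed

lemma covering_family_Suc:
  fixes F G :: "('a::{finite,field}^'n) set set"
  assumes G: "G \<subseteq> Pm f m2" "t \<le> m2"
    and F: "\<And>A. A \<in> F \<Longrightarrow> tot_iso f A" and cross: "cross_t_intersecting F G t"
    and \<T>: "covering_family f F d \<T>" and d: "d < tau f t G"
  obtains \<T>' where "covering_family f F (Suc d) \<T>'"
    "real (card \<T>') \<le> real (card \<T>) * gauss_binom CARD('a) (m2 - t + 1) 1"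
proof -
  let ?L = "gauss_binom CARD('a) (m2 - t + 1) 1"
  have "\<forall>T\<in>\<T>. \<exists>\<S>. covering_family f {A \<in> F. T \<subseteq> A} (Suc d) \<S> \<and> real (card \<S>) \<le> ?L"
  proof
    fix T assume "T \<in> \<T>"
    then have T: "tot_iso f T" and dim_T: "vec.dim T = d" using \<T> unfolding covering_family_def by auto
    then have "vec.dim T < tau f t G" using d by simp
    from branching_step[OF G F cross T this]
    show "\<exists>\<S>. covering_family f {A \<in> F. T \<subseteq> A} (Suc d) \<S> \<and> real (card \<S>) \<le> ?L"
      unfolding dim_T .
  qed
  from bchoice[OF this] obtain S
    where S: "\<forall>T\<in>\<T>. covering_family f {A \<in> F. T \<subseteq> A} (Suc d) (S T) \<and> real (card (S T)) \<le> ?L" ..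
  have "\<forall>W\<in>(\<Union>T\<in>\<T>. S T). tot_iso f W \<and> vec.dim W = Suc d"
    using S unfolding covering_family_def by blast
  moreover have "\<forall>A\<in>F. \<exists>W\<in>(\<Union>T\<in>\<T>. S T). W \<subseteq> A"
  proof
    fix A assume A: "A \<in> F"
    then obtain T where T: "T \<in> \<T>" "T \<subseteq> A" using \<T> unfolding covering_family_def by blast
    then obtain W where "W \<in> S T" "W \<subseteq> A" using S A unfolding covering_family_def by blast
    then show "\<exists>W\<in>(\<Union>T\<in>\<T>. S T). W \<subseteq> A" using T(1) by blast
  qed
  ultimately have "covering_family f F (Suc d) (\<Union>T\<in>\<T>. S T)" unfolding covering_family_def ..
  moreover have "real (card (\<Union>T\<in>\<T>. S T)) \<le> real (card \<T>) * ?L"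
    using S by (intro real_card_UN_le) auto
  ultimately show ?thesis by (rule that)
qed

lemma exists_covering_family:
  fixes F G :: "('a::{finite,field}^'n) set set"
  assumes G: "G \<subseteq> Pm f m2" "t \<le> m2"
    and F: "\<And>A. A \<in> F \<Longrightarrow> tot_iso f A" and cross: "cross_t_intersecting F G t"
    and X: "t_cover f t F X" and i: "t + i \<le> tau f t G"
  shows "\<exists>\<T>. covering_family f F (t + i) \<T>
           \<and> real (card \<T>) \<le> gauss_binom CARD('a) (vec.dim X) t * gauss_binom CARD('a) (m2 - t + 1) 1 ^ i"
  using i
proof (induction i)
  case 0
  then show ?case using covering_family_of_t_cover[OF F X] by simp
next
  case (Suc i)
  let ?L = "gauss_binom CARD('a) (m2 - t + 1) 1"
  obtain \<T> where \<T>: "covering_family f F (t + i) \<T>"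
    and card: "real (card \<T>) \<le> gauss_binom CARD('a) (vec.dim X) t * ?L ^ i"
    using Suc by auto
  obtain \<T>' where \<T>': "covering_family f F (t + Suc i) \<T>'"
    and card': "real (card \<T>') \<le> real (card \<T>) * ?L"
    using covering_family_Suc[OF G F cross \<T>] Suc.prems by auto
  have "0 \<le> ?L" using two_le_card_field[where 'a='a] by (intro gauss_binom_nonneg) simp
  then have "real (card \<T>') \<le> gauss_binom CARD('a) (vec.dim X) t * ?L ^ i * ?L"
    using card' mult_right_mono[OF card] by (meson order.trans)
  then show ?case using \<T>' unfolding power_Suc2 mult.assoc by blast
qed

theorem lemma2p3:
  fixes f :: "'a::{finite,field}^'n \<Rightarrow> 'a^'n \<Rightarrow> 'a"
    and \<nu> m1 m2 t :: nat
    and F G :: "('a^'n) set set"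
  assumes dim: "CARD('n) = 2 * \<nu>"
    and form: "alt_bilinear f" "nondegenerate f"
    and pos: "0 < t"
    and m1: "t \<le> m1" "m1 < \<nu>"
    and m2: "t \<le> m2" "m2 < \<nu>"
    and big: "2 * \<nu> \<ge> 2 * m1 + m2 - t"
    and FP: "F \<subseteq> Pm f m1" and GP: "G \<subseteq> Pm f m2"
    and ne: "F \<noteq> {}" "G \<noteq> {}"
    and cross: "cross_t_intersecting F G t"
  shows "real (card F) \<le>
           gauss_binom CARD('a) (tau f t F) t
         * gauss_binom CARD('a) (m2 - t + 1) 1 ^ (tau f t G - t)
         * Nprime CARD('a) (tau f t G) m1 \<nu>"
proof -
  let ?s = "tau f t G" and ?N = "Nprime CARD('a) (tau f t G) m1 \<nu>"
  obtain A0 B0 where A0: "A0 \<in> F" and B0: "B0 \<in> G" using ne by blast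
  have Fiso: "\<And>A. A \<in> F \<Longrightarrow> tot_iso f A" using FP unfolding Pm_def by auto
  obtain X where X: "t_cover f t F X" "vec.dim X = tau f t F"
    using t_cover_if_cross_t_intersecting[OF cross GP B0] by (rule obtain_minimum_t_cover)
  have cover_G: "t_cover f t G A0"
    using cross FP A0 by (intro t_cover_if_cross_t_intersecting) (auto simp: cross_t_intersecting_commute)
  have s: "t \<le> ?s" "?s \<le> m1" using le_tau[OF B0 cover_G] tau_le[OF cover_G] A0 FP by (auto simp: Pm_def)
  then obtain \<T> where \<T>: "covering_family f F ?s \<T>"
    "real (card \<T>) \<le> gauss_binom CARD('a) (tau f t F) t * gauss_binom CARD('a) (m2 - t + 1) 1 ^ (?s - t)"
    using exists_covering_family[OF GP m2(1) Fiso cross X(1), of "?s - t"] X(2) by auto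
  have "real (card F) \<le> real (card (\<Union>T\<in>\<T>. {A \<in> Pm f m1. T \<subseteq> A}))"
    using \<T>(1) FP unfolding covering_family_def by (intro of_nat_mono card_mono) auto
  also have "\<dots> \<le> real (card \<T>) * ?N"
  proof (rule real_card_UN_le)
    fix T assume "T \<in> \<T>"
    then show "real (card {A \<in> Pm f m1. T \<subseteq> A}) \<le> ?N"
      using \<T>(1) card_Pm_supersets_le[OF form dim, of T m1] s(2) m1(2)
      unfolding covering_family_def by auto
  qed simp
  also have "\<dots> \<le> gauss_binom CARD('a) (tau f t F) t * gauss_binom CARD('a) (m2 - t + 1) 1 ^ (?s - t) * ?N"
    using \<T>(2) Nprime_nonneg[of "CARD('a)"] by (intro mult_right_mono) simp_all
  finally show ?thesis .
qed

end
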